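(* Let \(\mathcal F\) be a family of irreflexive graphs that is closed under edge contraction. Let \(\vec{\mathcal F}\) be the set of all orientations of elements of \(\mathcal F\), and let \(\vec{\mathcal F}_c\) be the set of complete-convex orientations of elements of \(\mathcal F\). Then \(\chi_s(\vec{\mathcal F})=\chi(\vec{\mathcal F}_c)\).
   Context: Irreflexive means no loops; graphs have no parallel edges. A homomorphism \(\phi:\vec G\to\vec H\) of oriented graphs is a vertex map with \(\phi(u)\phi(v)\in A_{\vec H}\) for each arc \(uv\). For an irreflexive oriented graph \(\vec G\), \(\chi(\vec G)\) is the least \(k\) such that \(\vec G\) has a homomorphism to some loopless tournament on \(k\) vertices; \(\chi_s(\vec G)\) is the least \(k\) such that \(\vec G\) has a non-trivial homomorphism to a reflexive tournament (loop at every vertex) on \(k\) vertices, a homomorphism being trivial when every arc is mapped to the same loop. For a family \(\vec{\mathcal F}\), \(\chi(\vec{\mathcal F})\) (resp. \(\chi_s(\vec{\mathcal F})\)) is the least \(k\) with \(\chi(\vec F)\le k\) (resp. \(\chi_s(\vec F)\le k\)) for all \(\vec F\in\vec{\mathcal F}\). A \(2\)-dipath \(u,v,w\) with centre \(v\): \(uv,vw\) arcs, \(u\ne v\ne w\). A vertex set \(S\) is convex if no vertex outside \(S\) is the centre of a \(2\)-dipath with ends in \(S\); \(conv(S)\) is the smallest convex superset; an oriented graph is complete convex if \(conv(\{u,v\})\) is the whole vertex set for every arc \(uv\).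
   Formalization: Graphs are taken finite, and the family is also assumed to contain, up to isomorphism, the connected components of its members (automatic for connected graphs); without this the claim fails, e.g. for {C_3+K_1, K_2+K_1, 2K_1}. Homomorphisms of edgeless graphs count as non-trivial. *)

theory Defs
  imports "Graph_Theory.Graph_Theory" "HOL-Library.Extended_Nat"
begin

text \<open>
  Undirected graphs are the symmetric digraphs of \<^theory>\<open>Graph_Theory.Pair_Digraph\<close>:
  \<^const>\<open>pair_graph\<close> is a finite graph without loops or parallel edges, an edge being a pair of
  opposite arcs.
\<close>

section \<open>Oriented graphs, tournaments and homomorphisms\<close>

text \<open>Loops are permitted in an oriented graph; opposite arcs between distinct vertices are not.\<close>

locale oriented_graph = pair_fin_digraph G for G :: "'a pair_pre_digraph" +
  assumes antisym_arcs: "antisym (parcs G)"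

locale irreflexive_oriented_graph = oriented_graph G + pair_loopfree_digraph G
  for G :: "'a pair_pre_digraph"

locale tournament = irreflexive_oriented_graph G for G :: "'a pair_pre_digraph" +
  assumes total_arcs: "total_on (pverts G) (parcs G)"

locale reflexive_tournament = oriented_graph G for G :: "'a pair_pre_digraph" +
  assumes total_arcs: "total_on (pverts G) (parcs G)"
    and refl_arcs: "refl_on (pverts G) (parcs G)"

definition digraph_hom :: "'a pair_pre_digraph \<Rightarrow> 'b pair_pre_digraph \<Rightarrow> ('a \<Rightarrow> 'b) \<Rightarrow> bool" where
  "digraph_hom G H \<phi> \<longleftrightarrow>
     \<phi> ` pverts G \<subseteq> pverts H \<and> (\<forall>(u, v) \<in> parcs G. (\<phi> u, \<phi> v) \<in> parcs H)"

text \<open>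
  The arcs are sent to one single loop. If there are no arcs the image is empty, so a homomorphism
  from an edgeless graph counts as non-trivial. With the opposite convention no edgeless graph
  would have a non-trivial homomorphism at all, and a family closed under edge contraction always
  contains edgeless graphs.
\<close>

definition trivial_hom :: "'a pair_pre_digraph \<Rightarrow> ('a \<Rightarrow> 'b) \<Rightarrow> bool" where
  "trivial_hom G \<phi> \<longleftrightarrow> (\<exists>x. map_prod \<phi> \<phi> ` parcs G = {(x, x)})"


section \<open>Chromatic numbers\<close>

text \<open>
  All ``least \<open>k\<close>'' are taken in \<^typ>\<open>enat\<close>, where the infimum of a non-empty set is its least
  element and \<open>\<infinity>\<close> means that no \<open>k\<close> exists. Target tournaments are finite, so vertices of
  type \<^typ>\<open>nat\<close> are no restriction.
\<close>

definition chromatic_number :: "'a pair_pre_digraph \<Rightarrow> enat" where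
  "chromatic_number G = Inf {enat k | k. \<exists>(T :: nat pair_pre_digraph) \<phi>.
     tournament T \<and> card (pverts T) = k \<and> digraph_hom G T \<phi>}"

definition simple_chromatic_number :: "'a pair_pre_digraph \<Rightarrow> enat" where
  "simple_chromatic_number G = Inf {enat k | k. \<exists>(T :: nat pair_pre_digraph) \<phi>.
     reflexive_tournament T \<and> card (pverts T) = k \<and> digraph_hom G T \<phi> \<and> \<not> trivial_hom G \<phi>}"

definition family_chromatic_number :: "'a pair_pre_digraph set \<Rightarrow> enat" where
  "family_chromatic_number \<F> = Inf {k. \<forall>F \<in> \<F>. chromatic_number F \<le> k}"

definition family_simple_chromatic_number :: "'a pair_pre_digraph set \<Rightarrow> enat" where
  "family_simple_chromatic_number \<F> = Inf {k. \<forall>F \<in> \<F>. simple_chromatic_number F \<le> k}"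


section \<open>Convexity\<close>

definition two_dipath :: "'a pair_pre_digraph \<Rightarrow> 'a \<Rightarrow> 'a \<Rightarrow> 'a \<Rightarrow> bool" where
  "two_dipath G u v w \<longleftrightarrow> (u, v) \<in> parcs G \<and> (v, w) \<in> parcs G \<and> u \<noteq> v \<and> v \<noteq> w"

definition convex_verts :: "'a pair_pre_digraph \<Rightarrow> 'a set \<Rightarrow> bool" where
  "convex_verts G S \<longleftrightarrow> S \<subseteq> pverts G \<and>
     \<not> (\<exists>v \<in> pverts G - S. \<exists>u \<in> S. \<exists>w \<in> S. two_dipath G u v w)"

definition complete_convex :: "'a pair_pre_digraph \<Rightarrow> bool" where
  "complete_convex G \<longleftrightarrow> (\<forall>(u, v) \<in> parcs G. convex_verts G hull {u, v} = pverts G)"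

lemma convex_verts_hull:
  assumes "S \<subseteq> pverts G"
  shows "convex_verts G (convex_verts G hull S)"
proof -
  have "convex_verts G (pverts G)"
    by (simp add: convex_verts_def)
  with assms have "convex_verts G hull S \<subseteq> pverts G"
    by (rule hull_minimal)
  moreover have "v \<in> convex_verts G hull S"
    if "v \<in> pverts G" "two_dipath G u v w"
      and uw: "u \<in> convex_verts G hull S" "w \<in> convex_verts G hull S" for u v w
    unfolding hull_def
  proof (clarify)
    fix C
    assume C: "convex_verts G C" "S \<subseteq> C"
    then have "u \<in> C" "w \<in> C"
      using uw hull_minimal[OF C(2), of "convex_verts G"] by auto
    with C(1) that(1,2) show "v \<in> C"
      by (auto simp: convex_verts_def)
  qed
  ultimately show ?thesis
    by (auto simp: convex_verts_def)
qed


section \<open>Families of graphs\<close>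

definition orientations :: "'a pair_pre_digraph \<Rightarrow> 'a pair_pre_digraph set" where
  "orientations G = {D. irreflexive_oriented_graph D \<and> mk_symmetric (with_proj D) = G}"

definition family_orientations :: "'a pair_pre_digraph set \<Rightarrow> 'a pair_pre_digraph set" where
  "family_orientations \<F> = (\<Union>G \<in> \<F>. orientations G)"

definition complete_convex_orientations :: "'a pair_pre_digraph set \<Rightarrow> 'a pair_pre_digraph set" where
  "complete_convex_orientations \<F> = {D \<in> family_orientations \<F>. complete_convex D}"

text \<open>
  Contracting the edge \<open>uv\<close> identifies \<open>v\<close> with \<open>u\<close>, merges parallel edges, and removes the loop
  that arises from \<open>uv\<close> itself.
\<close>

definition contract_edge :: "'a pair_pre_digraph \<Rightarrow> 'a \<Rightarrow> 'a \<Rightarrow> 'a pair_pre_digraph" where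
  "contract_edge G u v =
     \<lparr> pverts = id(v := u) ` pverts G,
       parcs = map_prod (id(v := u)) (id(v := u)) ` parcs G - {(u, u)} \<rparr>"

text \<open>Graphs are considered up to isomorphism, so the names of the vertices do not matter.\<close>

definition closed_under_edge_contraction :: "'a pair_pre_digraph set \<Rightarrow> bool" where
  "closed_under_edge_contraction \<F> \<longleftrightarrow> (\<forall>G \<in> \<F>. \<forall>(u, v) \<in> parcs G. \<exists>H \<in> \<F>.
     digraph_iso (with_proj (contract_edge G u v)) (with_proj H))"

text \<open>
  On symmetric digraphs the strongly connected components are the connected components.
  A disconnected graph with an edge has no complete-convex orientation, since the convex hull of
  an arc stays inside one component; so the components have to be available in the family.
\<close>

definition closed_under_components :: "'a pair_pre_digraph set \<Rightarrow> bool" where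
  "closed_under_components \<F> \<longleftrightarrow> (\<forall>G \<in> \<F>. \<forall>C \<in> pre_digraph.sccs (with_proj G). \<exists>H \<in> \<F>.
     digraph_iso C (with_proj H))"

text \<open>Every family of connected graphs is closed under components.\<close>

lemma connected_imp_closed_under_components:
  assumes "\<forall>G \<in> \<F>. pair_graph G \<and> connected (with_proj G)"
  shows "closed_under_components \<F>"
  unfolding closed_under_components_def
proof (intro ballI)
  fix G C
  assume G: "G \<in> \<F>" and C: "C \<in> pre_digraph.sccs (with_proj G)"
  interpret pair_graph G using assms G by blast
  have conn: "connected (with_proj G)" using assms G by blast
  have sc: "strongly_connected (with_proj G)"
    using symmetric_connected_imp_strongly_connected[OF sym_arcs conn] .
  have ind: "induced_subgraph C (with_proj G)" and
    max: "\<not> (\<exists>H'. induced_subgraph H' (with_proj G) \<and> strongly_connected H' \<and> verts C \<subset> verts H')"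
    using C by (simp_all add: pre_digraph.sccs_def)
  have wf: "\<And>a b. (a, b) \<in> parcs G \<Longrightarrow> a \<in> pverts G \<and> b \<in> pverts G"
    using wellformed' by blast
  have "induced_subgraph (with_proj G) (with_proj G)"
    unfolding induced_subgraph_def subgraph_def compatible_def with_proj_simps
    using wf_digraph wf by force
  moreover have "verts C \<subseteq> pverts G"
    using ind unfolding induced_subgraph_def subgraph_def with_proj_simps by blast
  ultimately have verts: "verts C = pverts G"
    using max sc by (metis psubsetI with_proj_simps(1))
  have "compatible (with_proj G) C"
    using ind unfolding induced_subgraph_def subgraph_def by blast
  then have ends: "tail C = fst" "head C = snd"
    by (simp_all add: compatible_def)
  have "arcs C = {e \<in> parcs G. fst e \<in> pverts G \<and> snd e \<in> pverts G}"
    using ind unfolding induced_subgraph_def with_proj_simps verts by blast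
  then have "arcs C = parcs G"
    using wf by force
  with verts ends have "C = with_proj G"
    by (simp add: with_proj_def)
  moreover have "digraph_iso (with_proj G) (with_proj G)"
  proof -
    let ?f = "\<lparr>iso_verts = id, iso_arcs = id, iso_head = snd, iso_tail = fst\<rparr>"
    have "pre_digraph.digraph_isomorphism (with_proj G) ?f"
      using wf_digraph by (simp add: pre_digraph.digraph_isomorphism_def)
    moreover have "with_proj G = app_iso ?f (with_proj G)"
      unfolding app_iso_def by (simp add: with_proj_def)
    ultimately show ?thesis
      unfolding digraph_iso_def by blast
  qed
  ultimately show "\<exists>H \<in> \<F>. digraph_iso C (with_proj H)"
    using G by auto
qed

end

theory Submission
  imports Defs
begin

text \<open>
  A homomorphism to a reflexive tournament that sends an arc to a loop collapses the convex hull of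
  that arc, because the preimage of a vertex is convex. So on a complete-convex oriented graph the
  non-trivial homomorphisms to reflexive tournaments are exactly the homomorphisms to loopless
  tournaments, and \<open>\<chi>\<^sub>s\<close> agrees with \<open>\<chi>\<close>.
  An orientation that is not complete convex has a smaller quotient in the family with at least the
  same \<open>\<chi>\<^sub>s\<close>. If an arc spans a proper convex set, then growing a contracted set from this arc by
  centres of \<open>2\<close>-dipaths ends in a convex set, so that contracting it creates no opposite
  arcs. If no arc leaves this set, then the graph is disconnected, and everything outside one
  component is collapsed to a vertex of that component instead.
\<close>

section \<open>Unfolded graph classes and bounds for the chromatic numbers\<close>

lemma pair_graph_arcs:
  assumes "pair_graph G" "(a, b) \<in> parcs G"
  shows "a \<in> pverts G" "b \<in> pverts G" "a \<noteq> b" "(b, a) \<in> parcs G"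
proof -
  interpret pair_graph G by fact
  show "a \<in> pverts G" "b \<in> pverts G" using assms(2) wellformed' by auto
  show "a \<noteq> b" using assms(2) pair_no_loops by force
  show "(b, a) \<in> parcs G" using assms(2) pair_sym_arcs by (auto simp: symmetric_def dest: symD)
qed

lemma oriented_graph_iff:
  "oriented_graph D \<longleftrightarrow> finite (pverts D) \<and> parcs D \<subseteq> pverts D \<times> pverts D \<and> antisym (parcs D)"
proof
  assume "oriented_graph D"
  then interpret oriented_graph D .
  show "finite (pverts D) \<and> parcs D \<subseteq> pverts D \<times> pverts D \<and> antisym (parcs D)"
    using pair_finite_verts antisym_arcs wellformed' by auto
next
  assume "finite (pverts D) \<and> parcs D \<subseteq> pverts D \<times> pverts D \<and> antisym (parcs D)"
  then show "oriented_graph D"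
    by unfold_locales (auto intro: finite_subset)
qed

lemma irreflexive_oriented_graph_iff:
  "irreflexive_oriented_graph D \<longleftrightarrow> oriented_graph D \<and> (\<forall>a. (a, a) \<notin> parcs D)"
proof
  assume "irreflexive_oriented_graph D"
  then interpret irreflexive_oriented_graph D .
  have "(a, a) \<notin> parcs D" for a
    using pair_no_loops[of "(a, a)"] by auto
  moreover have "oriented_graph D"
    by unfold_locales
  ultimately show "oriented_graph D \<and> (\<forall>a. (a, a) \<notin> parcs D)"
    by simp
next
  assume D: "oriented_graph D \<and> (\<forall>a. (a, a) \<notin> parcs D)"
  then interpret oriented_graph D by blast
  show "irreflexive_oriented_graph D"
    using D by unfold_locales auto
qed

lemma tournament_iff:
  "tournament T \<longleftrightarrow> irreflexive_oriented_graph T \<and> total_on (pverts T) (parcs T)"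
  by (simp add: tournament_def tournament_axioms_def)

lemma reflexive_tournament_iff:
  "reflexive_tournament T \<longleftrightarrow>
     oriented_graph T \<and> total_on (pverts T) (parcs T) \<and> refl_on (pverts T) (parcs T)"
  by (simp add: reflexive_tournament_def reflexive_tournament_axioms_def)

lemma chromatic_number_le:
  fixes T :: "nat pair_pre_digraph"
  assumes "tournament T" "digraph_hom G T \<phi>"
  shows "chromatic_number G \<le> enat (card (pverts T))"
  unfolding chromatic_number_def using assms by (intro Inf_lower) blast

lemma chromatic_number_greatest:
  assumes "\<And>(T :: nat pair_pre_digraph) \<phi>. tournament T \<Longrightarrow> digraph_hom G T \<phi> \<Longrightarrow>
    k \<le> enat (card (pverts T))"
  shows "k \<le> chromatic_number G"
  unfolding chromatic_number_def using assms by (intro Inf_greatest) blast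

lemma simple_chromatic_number_le:
  fixes T :: "nat pair_pre_digraph"
  assumes "reflexive_tournament T" "digraph_hom G T \<phi>" "\<not> trivial_hom G \<phi>"
  shows "simple_chromatic_number G \<le> enat (card (pverts T))"
  unfolding simple_chromatic_number_def using assms by (intro Inf_lower) blast

lemma simple_chromatic_number_greatest:
  assumes "\<And>(T :: nat pair_pre_digraph) \<phi>. reflexive_tournament T \<Longrightarrow> digraph_hom G T \<phi> \<Longrightarrow>
    \<not> trivial_hom G \<phi> \<Longrightarrow> k \<le> enat (card (pverts T))"
  shows "k \<le> simple_chromatic_number G"
  unfolding simple_chromatic_number_def using assms by (intro Inf_greatest) blast


section \<open>Complete-convex oriented graphs\<close>

text \<open>Adding all loops to a tournament makes it reflexive, and a homomorphism into the
  loopless one puts no arc on a loop. An edgeless \<open>D\<close> is covered too, as its empty arc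
  image is not a singleton.\<close>

lemma simple_chromatic_number_le_chromatic_number:
  "simple_chromatic_number D \<le> chromatic_number D"
proof (rule chromatic_number_greatest)
  fix T :: "nat pair_pre_digraph" and \<phi>
  assume T: "tournament T" and \<phi>: "digraph_hom D T \<phi>"
  let ?T = "T\<lparr>parcs := parcs T \<union> Id_on (pverts T)\<rparr>"
  have "reflexive_tournament ?T"
    using T by (auto simp: reflexive_tournament_iff tournament_iff irreflexive_oriented_graph_iff
        oriented_graph_iff antisym_def total_on_def refl_on_def)
  moreover have "digraph_hom D ?T \<phi>"
    using \<phi> by (auto simp: digraph_hom_def)
  moreover have "\<not> trivial_hom D \<phi>"
  proof
    assume "trivial_hom D \<phi>"
    then obtain x where x: "map_prod \<phi> \<phi> ` parcs D = {(x, x)}"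
      by (auto simp: trivial_hom_def)
    then have "(x, x) \<in> map_prod \<phi> \<phi> ` parcs D" by simp
    then have "(x, x) \<in> parcs T" using \<phi> by (fastforce simp: digraph_hom_def)
    then show False using T by (simp add: tournament_iff irreflexive_oriented_graph_iff)
  qed
  ultimately show "simple_chromatic_number D \<le> enat (card (pverts T))"
    using simple_chromatic_number_le by fastforce
qed

text \<open>A 2-dipath with both ends over \<open>x\<close> maps to \<open>(x, \<phi> v)\<close> and
  \<open>(\<phi> v, x)\<close>, so antisymmetry puts its centre over \<open>x\<close> as
  well.\<close>

lemma convex_verts_fibre:
  assumes "digraph_hom D T \<phi>" "oriented_graph T"
  shows "convex_verts D {v \<in> pverts D. \<phi> v = x}"
proof -
  have "\<phi> v = x" if "two_dipath D u v w" "\<phi> u = x" "\<phi> w = x" for u v w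
  proof -
    have "(x, \<phi> v) \<in> parcs T" "(\<phi> v, x) \<in> parcs T"
      using that assms(1) by (auto simp: two_dipath_def digraph_hom_def)
    then show ?thesis
      using assms(2) by (auto simp: oriented_graph_iff dest: antisymD)
  qed
  then show ?thesis
    unfolding convex_verts_def by blast
qed

text \<open>An arc sent to a loop would make its fibre, being convex, contain all vertices, and the
  homomorphism would be trivial. Hence the loops of \<open>T\<close> can be deleted.\<close>

lemma chromatic_number_le_simple_chromatic_number:
  assumes D: "oriented_graph D" and cc: "complete_convex D"
  shows "chromatic_number D \<le> simple_chromatic_number D"
proof (rule simple_chromatic_number_greatest)
  fix T :: "nat pair_pre_digraph" and \<phi>
  assume T: "reflexive_tournament T" and \<phi>: "digraph_hom D T \<phi>" and nontriv: "\<not> trivial_hom D \<phi>"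
  have no_loop: "\<phi> a \<noteq> \<phi> b" if ab: "(a, b) \<in> parcs D" for a b
  proof
    assume eq: "\<phi> a = \<phi> b"
    let ?P = "{v \<in> pverts D. \<phi> v = \<phi> a}"
    have "convex_verts D ?P"
      using convex_verts_fibre \<phi> T by (auto simp: reflexive_tournament_iff)
    moreover have "{a, b} \<subseteq> ?P" using ab eq D by (auto simp: oriented_graph_iff)
    ultimately have "convex_verts D hull {a, b} \<subseteq> ?P" by (rule hull_minimal[rotated])
    moreover have "convex_verts D hull {a, b} = pverts D"
      using cc ab by (auto simp: complete_convex_def)
    ultimately have "pverts D \<subseteq> ?P" by simp
    then have const: "\<phi> v = \<phi> a" if "v \<in> pverts D" for v using that by auto
    have "map_prod \<phi> \<phi> e = (\<phi> a, \<phi> a)" if "e \<in> parcs D" for e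
      using that D const by (cases e) (auto simp: oriented_graph_iff)
    then have "map_prod \<phi> \<phi> ` parcs D = (\<lambda>_. (\<phi> a, \<phi> a)) ` parcs D"
      by (rule image_cong[OF refl])
    \<comment> \<open>The arc \<open>(a, b)\<close> makes the image non-empty, which
      \<open>trivial_hom\<close> demands.\<close>
    also have "\<dots> = {(\<phi> a, \<phi> a)}"
      using ab by (rule image_constant)
    finally show False using nontriv by (auto simp: trivial_hom_def)
  qed
  let ?T = "T\<lparr>parcs := parcs T - Id\<rparr>"
  have "tournament ?T"
    using T by (auto simp: reflexive_tournament_iff tournament_iff irreflexive_oriented_graph_iff
        oriented_graph_iff antisym_def total_on_def)
  moreover have "digraph_hom D ?T \<phi>"
    using \<phi> no_loop by (auto simp: digraph_hom_def)
  ultimately show "chromatic_number D \<le> enat (card (pverts T))"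
    using chromatic_number_le by fastforce
qed


section \<open>Quotients\<close>

text \<open>On loopless graphs, edge contraction, passage to a component and relabelling are all
  instances, and the same \<open>f\<close> acts on a graph and on its orientations.\<close>

definition quotient_graph :: "('a \<Rightarrow> 'b) \<Rightarrow> 'a pair_pre_digraph \<Rightarrow> 'b pair_pre_digraph" where
  "quotient_graph f G = \<lparr> pverts = f ` pverts G, parcs = map_prod f f ` parcs G - Id \<rparr>"

lemma pverts_quotient [simp]: "pverts (quotient_graph f G) = f ` pverts G"
  by (simp add: quotient_graph_def)

lemma in_parcs_quotient:
  "(x, y) \<in> parcs (quotient_graph f G) \<longleftrightarrow> x \<noteq> y \<and> (\<exists>(a, b) \<in> parcs G. x = f a \<and> y = f b)"
  by (auto simp: quotient_graph_def)

text \<open>A loop deleted at the first stage would only give a loop at the second, so successive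
  contractions merge into one map.\<close>

lemma quotient_quotient: "quotient_graph g (quotient_graph f G) = quotient_graph (g \<circ> f) G"
proof -
  have "e \<in> parcs (quotient_graph g (quotient_graph f G)) \<longleftrightarrow>
      e \<in> parcs (quotient_graph (g \<circ> f) G)" for e
    by (cases e) (auto simp: in_parcs_quotient Bex_def, metis+)
  then have "parcs (quotient_graph g (quotient_graph f G)) = parcs (quotient_graph (g \<circ> f) G)"
    by blast
  then show ?thesis
    by (simp add: image_comp)
qed

lemma quotient_id:
  assumes "pair_graph G"
  shows "quotient_graph id G = G"
proof -
  have "parcs G - Id = parcs G"
    using pair_graph_arcs(3)[OF assms] by blast
  then show ?thesis
    by (simp add: quotient_graph_def prod.map_id0)
qed

text \<open>\<open>G\<close> has no loops and only \<open>u\<close> and \<open>v\<close> are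
  identified, so every loop in the image sits at \<open>u\<close>, and deleting
  \<open>(u, u)\<close> amounts to deleting all of \<open>Id\<close>.\<close>

lemma contract_edge_eq_quotient:
  fixes G :: "'a pair_pre_digraph"
  assumes "pair_graph G" "(u, v) \<in> parcs G"
  shows "contract_edge G u v = quotient_graph (id(v := u)) G"
proof -
  have *: "r - {(u, u)} = r - Id"
    if "\<And>a b. (a, b) \<in> r \<Longrightarrow> (a, b) = (u, u) \<longleftrightarrow> a = b" for r :: "'a rel"
    using that by auto
  let ?r = "map_prod (id(v := u)) (id(v := u)) ` parcs G"
  have "(a, b) = (u, u) \<longleftrightarrow> a = b" if "(a, b) \<in> ?r" for a b
    using that pair_graph_arcs(3)[OF assms(1)] by (auto split: if_splits)
  then have "?r - {(u, u)} = ?r - Id"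
    by (rule *)
  then show ?thesis
    by (simp add: contract_edge_def quotient_graph_def)
qed

lemma in_parcs_mk_symmetric:
  "(a, b) \<in> parcs (mk_symmetric (with_proj D)) \<longleftrightarrow> (a, b) \<in> parcs D \<or> (b, a) \<in> parcs D"
  by (auto simp: parcs_mk_symmetric intro: rev_bexI)

text \<open>Links the two levels: the closure properties place a quotient of the underlying graph in
  the family, and this carries over to the quotient of the orientation.\<close>

lemma mk_symmetric_quotient:
  "mk_symmetric (with_proj (quotient_graph f D)) = quotient_graph f (mk_symmetric (with_proj D))"
proof -
  have "e \<in> parcs (mk_symmetric (with_proj (quotient_graph f D))) \<longleftrightarrow>
      e \<in> parcs (quotient_graph f (mk_symmetric (with_proj D)))" for e
    by (cases e) (fastforce simp only: in_parcs_quotient in_parcs_mk_symmetric split: prod.splits)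
  then have "parcs (mk_symmetric (with_proj (quotient_graph f D))) =
      parcs (quotient_graph f (mk_symmetric (with_proj D)))"
    by blast
  then show ?thesis
    by simp
qed

text \<open>Loops are deleted by construction, so opposite arcs are the only obstruction.\<close>

lemma irreflexive_oriented_graph_quotient:
  assumes "oriented_graph D" "antisym (parcs (quotient_graph f D))"
  shows "irreflexive_oriented_graph (quotient_graph f D)"
proof -
  have "parcs (quotient_graph f D) \<subseteq> f ` pverts D \<times> f ` pverts D"
    using assms(1) by (auto simp: oriented_graph_iff in_parcs_quotient intro!: imageI)
  then show ?thesis
    using assms
    by (simp add: irreflexive_oriented_graph_iff oriented_graph_iff in_parcs_quotient)
qed

text \<open>Loops in the target make up for the arcs of \<open>D\<close> that are lost in the quotient.\<close>

lemma simple_chromatic_number_quotient: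
  assumes D: "oriented_graph D" and arcs: "parcs (quotient_graph f D) \<noteq> {}"
  shows "simple_chromatic_number D \<le> simple_chromatic_number (quotient_graph f D)"
proof (rule simple_chromatic_number_greatest)
  fix T :: "nat pair_pre_digraph" and \<phi>
  assume T: "reflexive_tournament T" and \<phi>: "digraph_hom (quotient_graph f D) T \<phi>"
    and nontriv: "\<not> trivial_hom (quotient_graph f D) \<phi>"
  have "(\<phi> (f a), \<phi> (f b)) \<in> parcs T" if ab: "(a, b) \<in> parcs D" for a b
  proof (cases "f a = f b")
    case True
    have "f a \<in> pverts (quotient_graph f D)" using ab D by (auto simp: oriented_graph_iff)
    with \<phi> have "\<phi> (f a) \<in> pverts T" unfolding digraph_hom_def by blast
    with True T show ?thesis by (auto simp: reflexive_tournament_iff refl_on_def)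
  next
    case False
    with ab have "(f a, f b) \<in> parcs (quotient_graph f D)" by (auto simp: in_parcs_quotient)
    with \<phi> show ?thesis by (auto simp: digraph_hom_def)
  qed
  then have "digraph_hom D T (\<phi> \<circ> f)"
    using \<phi> by (auto simp: digraph_hom_def image_subset_iff)
  moreover have "\<not> trivial_hom D (\<phi> \<circ> f)"
  proof
    assume "trivial_hom D (\<phi> \<circ> f)"
    then obtain x where x: "map_prod (\<phi> \<circ> f) (\<phi> \<circ> f) ` parcs D = {(x, x)}"
      by (auto simp: trivial_hom_def)
    \<comment> \<open>By \<open>arcs\<close> the left side is a non-empty part of
      \<open>{(x, x)}\<close>. For an edgeless quotient it would be empty and there would be no
      contradiction.\<close>
    have "map_prod \<phi> \<phi> ` parcs (quotient_graph f D) \<subseteq> map_prod (\<phi> \<circ> f) (\<phi> \<circ> f) ` parcs D"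
      by (force simp: quotient_graph_def)
    with x arcs have "map_prod \<phi> \<phi> ` parcs (quotient_graph f D) = {(x, x)}"
      by (metis image_is_empty subset_singletonD)
    with nontriv show False by (auto simp: trivial_hom_def)
  qed
  ultimately show "simple_chromatic_number D \<le> enat (card (pverts T))"
    using T by (intro simple_chromatic_number_le)
qed

text \<open>An isomorphism carries its own arc map and new head and tail maps. As the ends are given
  by the projections on both sides, the vertex map determines the arc map.\<close>

lemma digraph_iso_with_projE:
  assumes "digraph_iso C (with_proj H)" "tail C = fst" "head C = snd"
  obtains h where "inj_on h (verts C)" "pverts H = h ` verts C" "parcs H = map_prod h h ` arcs C"
proof -
  obtain i where i: "pre_digraph.digraph_isomorphism C i" and H: "with_proj H = app_iso i C"
    using assms(1) by (auto simp: digraph_iso_def)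
  have "verts (with_proj H) = iso_verts i ` verts C" "arcs (with_proj H) = iso_arcs i ` arcs C"
    "tail (with_proj H) = iso_tail i" "head (with_proj H) = iso_head i"
    by (simp_all add: H)
  then have vH: "pverts H = iso_verts i ` verts C" and aH: "parcs H = iso_arcs i ` arcs C"
    and ends: "iso_tail i = fst" "iso_head i = snd"
    by simp_all
  have "iso_arcs i e = map_prod (iso_verts i) (iso_verts i) e" if "e \<in> arcs C" for e
    using i that assms(2,3) ends
    by (auto simp: pre_digraph.digraph_isomorphism_def prod_eq_iff)
  then have "parcs H = map_prod (iso_verts i) (iso_verts i) ` arcs C"
    unfolding aH by (rule image_cong[OF refl])
  then show ?thesis
    using that[of "iso_verts i"] i vH by (auto simp: pre_digraph.digraph_isomorphism_def)
qed


section \<open>Contracting vertex sets and isolating components\<close>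

text \<open>Closure under contraction holds only up to isomorphism, so \<open>f\<close> is
  prescribed by its kernel alone and the names of the new vertices stay free.\<close>

definition contractible :: "'a pair_pre_digraph set \<Rightarrow> 'a pair_pre_digraph \<Rightarrow> 'a set \<Rightarrow> bool" where
  "contractible \<F> G S \<longleftrightarrow> (\<exists>f. quotient_graph f G \<in> \<F> \<and>
     (\<forall>x \<in> pverts G. \<forall>y \<in> pverts G. f x = f y \<longleftrightarrow> x = y \<or> x \<in> S \<and> y \<in> S))"

lemma contractible_singleton:
  assumes "pair_graph G" "G \<in> \<F>"
  shows "contractible \<F> G {u}"
  unfolding contractible_def using assms quotient_id[OF assms(1)] by (intro exI[of _ id]) auto

text \<open>In the quotient \<open>S\<close> is a single vertex adjacent to the image of
  \<open>v\<close>, so one edge contraction absorbs \<open>v\<close>.\<close>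

lemma contractible_insert:
  assumes graphs: "\<forall>G \<in> \<F>. pair_graph G" and closed: "closed_under_edge_contraction \<F>"
    and G: "pair_graph G"
    and S: "contractible \<F> G S" "s \<in> S" "v \<notin> S" "(s, v) \<in> parcs G"
  shows "contractible \<F> G (insert v S)"
proof -
  obtain f where f: "quotient_graph f G \<in> \<F>" and
    ker: "\<And>x y. x \<in> pverts G \<Longrightarrow> y \<in> pverts G \<Longrightarrow> f x = f y \<longleftrightarrow> x = y \<or> x \<in> S \<and> y \<in> S"
    using S(1) by (auto simp: contractible_def)
  have sv: "s \<in> pverts G" "v \<in> pverts G" "s \<noteq> v"
    using pair_graph_arcs G S(4) by metis+
  let ?c = "id(f v := f s)"
  have "f s \<noteq> f v" using ker sv S(3) by simp
  then have edge: "(f s, f v) \<in> parcs (quotient_graph f G)"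
    using S(4) by (auto simp: in_parcs_quotient)
  then obtain H where H: "H \<in> \<F>"
    and iso: "digraph_iso (with_proj (contract_edge (quotient_graph f G) (f s) (f v))) (with_proj H)"
    using closed f unfolding closed_under_edge_contraction_def by blast
  have "contract_edge (quotient_graph f G) (f s) (f v) = quotient_graph ?c (quotient_graph f G)"
    by (rule contract_edge_eq_quotient[OF graphs[rule_format, OF f] edge])
  then have eq: "contract_edge (quotient_graph f G) (f s) (f v) = quotient_graph (?c \<circ> f) G"
    by (simp add: quotient_quotient)
  note iso' = iso[unfolded eq]
  obtain h where h: "inj_on h ((?c \<circ> f) ` pverts G)" "pverts H = h ` (?c \<circ> f) ` pverts G"
    "parcs H = map_prod h h ` parcs (quotient_graph (?c \<circ> f) G)"
    by (rule digraph_iso_with_projE[OF iso' with_proj_simps(4) with_proj_simps(5),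
          unfolded with_proj_simps pverts_quotient])
  \<comment> \<open>Since \<open>H\<close> is loopless, removing \<open>Id\<close> changes nothing,
    and the relabelling \<open>h\<close> is itself a quotient map.\<close>
  have "parcs H \<inter> Id = {}"
    using pair_graph_arcs(3)[OF graphs[rule_format, OF H]] by blast
  then have "H = quotient_graph h (quotient_graph (?c \<circ> f) G)"
    using h(2,3) by (simp add: quotient_graph_def[of h] Diff_triv)
  then have "quotient_graph (h \<circ> (?c \<circ> f)) G \<in> \<F>"
    using H by (simp add: quotient_quotient)
  moreover have "(h \<circ> (?c \<circ> f)) x = (h \<circ> (?c \<circ> f)) y \<longleftrightarrow> x = y \<or> x \<in> insert v S \<and> y \<in> insert v S"
    if "x \<in> pverts G" "y \<in> pverts G" for x y
  proof -
    have "(h \<circ> (?c \<circ> f)) x = (h \<circ> (?c \<circ> f)) y \<longleftrightarrow> ?c (f x) = ?c (f y)"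
      using that h(1) by (simp add: inj_on_eq_iff)
    also have "\<dots> \<longleftrightarrow> x = y \<or> x \<in> insert v S \<and> y \<in> insert v S"
      using ker[OF that] ker[OF that(1) sv(2)] ker[OF that(2) sv(2)]
        ker[OF that(1) sv(1)] ker[OF that(2) sv(1)] S(2,3) by auto
    finally show ?thesis .
  qed
  ultimately show ?thesis
    unfolding contractible_def by blast
qed

text \<open>Among the contractible sets between \<open>{u, v}\<close> and \<open>C\<close> a maximal
  one is convex: the centre of a violating 2-dipath lies in \<open>C\<close>, by convexity of
  \<open>C\<close>, and is adjacent to the set, so it could be added.\<close>

lemma contractible_convex_extension:
  assumes graphs: "\<forall>G \<in> \<F>. pair_graph G" and closed: "closed_under_edge_contraction \<F>"
    and G: "mk_symmetric (with_proj D) \<in> \<F>"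
    and uv: "(u, v) \<in> parcs D"
    and C: "convex_verts D C" "u \<in> C" "v \<in> C"
  obtains S where "u \<in> S" "v \<in> S" "S \<subseteq> C" "convex_verts D S"
    "contractible \<F> (mk_symmetric (with_proj D)) S"
proof -
  let ?G = "mk_symmetric (with_proj D)"
  define A where "A = {S. u \<in> S \<and> v \<in> S \<and> S \<subseteq> C \<and> contractible \<F> ?G S}"
  have pg: "pair_graph ?G" using graphs G by blast
  interpret G: pair_graph ?G by fact
  have edge: "(a, b) \<in> parcs ?G" if "(a, b) \<in> parcs D" for a b
    using that by (simp add: in_parcs_mk_symmetric)
  have CV: "C \<subseteq> pverts D" using C(1) by (simp add: convex_verts_def)
  \<comment> \<open>Contracting the edge \<open>uv\<close> itself gives a first member of
    \<open>A\<close>.\<close>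
  have "contractible \<F> ?G (insert v {u})"
    using contractible_insert[OF graphs closed pg contractible_singleton[OF pg G], of u u v]
      edge[OF uv] pair_graph_arcs(3)[OF pg edge[OF uv]] by auto
  then have uv_mem: "{u, v} \<in> A" using C(2,3) by (simp add: A_def insert_commute)
  have "A \<subseteq> Pow (pverts ?G)" using CV by (auto simp: A_def)
  then have "finite A"
    using G.pair_finite_verts by (meson finite_Pow_iff finite_subset)
  from finite_has_maximal2[OF this uv_mem]
  obtain S where SA: "S \<in> A" and max: "\<And>S'. S' \<in> A \<Longrightarrow> S \<subseteq> S' \<Longrightarrow> S = S'"
    by blast
  then have S: "u \<in> S" "v \<in> S" "S \<subseteq> C" "contractible \<F> ?G S"
    by (simp_all add: A_def)
  have "convex_verts D S"
    unfolding convex_verts_def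
  proof (intro conjI notI)
    show "S \<subseteq> pverts D" using S CV by blast
    assume "\<exists>y \<in> pverts D - S. \<exists>x \<in> S. \<exists>z \<in> S. two_dipath D x y z"
    then obtain x y z where y: "y \<in> pverts D" "y \<notin> S" and xz: "x \<in> S" "z \<in> S"
      and path: "two_dipath D x y z" by blast
    have "y \<in> C" using C(1) y(1) xz S path unfolding convex_verts_def by blast
    moreover have "contractible \<F> ?G (insert y S)"
      using contractible_insert[OF graphs closed pg S(4) xz(1) y(2)] path edge
      by (simp add: two_dipath_def)
    ultimately have "insert y S \<in> A" using S by (simp add: A_def)
    then show False using max y(2) by blast
  qed
  with S that show ?thesis by blast
qed

text \<open>Opposite arcs of the quotient either lift to opposite arcs of \<open>D\<close>, or one
  of their ends is the class of \<open>S\<close> and they lift to a 2-dipath from \<open>S\<close>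
  to \<open>S\<close> through a vertex outside.\<close>

lemma antisym_quotient_convex:
  assumes D: "oriented_graph D" and S: "convex_verts D S"
    and ker: "\<And>x y. x \<in> pverts D \<Longrightarrow> y \<in> pverts D \<Longrightarrow> f x = f y \<longleftrightarrow> x = y \<or> x \<in> S \<and> y \<in> S"
  shows "antisym (parcs (quotient_graph f D))"
proof (rule antisymI, rule ccontr)
  fix x y
  assume "(x, y) \<in> parcs (quotient_graph f D)" "(y, x) \<in> parcs (quotient_graph f D)" and ne: "x \<noteq> y"
  then obtain a b c d where ab: "(a, b) \<in> parcs D" "x = f a" "y = f b"
    and cd: "(c, d) \<in> parcs D" "y = f c" "x = f d"
    by (auto simp: in_parcs_quotient)
  have V: "a \<in> pverts D" "b \<in> pverts D" "c \<in> pverts D" "d \<in> pverts D"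
    using ab cd D by (auto simp: oriented_graph_iff)
  have ad: "a = d \<or> a \<in> S \<and> d \<in> S" and bc: "b = c \<or> b \<in> S \<and> c \<in> S"
    using ker V ab cd by metis+
  have nS: "\<not> (a \<in> S \<and> b \<in> S)" and neq: "a \<noteq> b" "c \<noteq> d"
    using ker V ab ne cd by auto
  \<comment> \<open>The class of \<open>S\<close> is one vertex of the quotient and
    \<open>x\<close>, \<open>y\<close> are distinct, so at most one of them can be that
    class.\<close>
  consider "a = d" "b = c" | "a \<in> S" "d \<in> S" "b = c" "b \<notin> S" | "b \<in> S" "c \<in> S" "a = d" "a \<notin> S"
    using ad bc nS by blast
  then show False
  proof cases
    case 1
    then show ?thesis using D ab cd neq by (auto simp: oriented_graph_iff antisym_def)
  next
    case 2
    then have "two_dipath D a b d" using ab cd neq by (auto simp: two_dipath_def)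
    then show ?thesis using S 2 V unfolding convex_verts_def by blast
  next
    case 3
    then have "two_dipath D c a b" using ab cd neq by (auto simp: two_dipath_def)
    then show ?thesis using S 3 V unfolding convex_verts_def by blast
  qed
qed

text \<open>Passing to the component \<open>K\<close> of \<open>u\<close> is realised as a quotient,
  so that it also applies to orientations. No edge leaves \<open>K\<close>, so everything outside
  can be folded onto \<open>u\<close> without creating arcs.\<close>

lemma component_quotient:
  assumes graphs: "\<forall>G \<in> \<F>. pair_graph G" and closed: "closed_under_components \<F>"
    and G: "G \<in> \<F>" and u: "u \<in> pverts G"
  obtains f K where "u \<in> K" "K \<subseteq> pverts G" "\<And>v. v \<in> K \<Longrightarrow> u \<rightarrow>\<^sup>*\<^bsub>with_proj G\<^esub> v"
    "\<And>a b. (a, b) \<in> parcs G \<Longrightarrow> a \<in> K \<longleftrightarrow> b \<in> K" "inj_on f K"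
    "\<And>w. w \<notin> K \<Longrightarrow> f w = f u" "quotient_graph f G \<in> \<F>"
proof -
  interpret pair_graph G using graphs G by blast
  define K where "K = scc_of u"
  have uK: "u \<in> K" using in_scc_of_self u by (simp add: K_def)
  have K: "K \<in> sccs_verts" using scc_of_in_sccs_verts u by (simp add: K_def)
  then have KV: "K \<subseteq> pverts G" using sccs_verts_subsets by blast
  have reach: "u \<rightarrow>\<^sup>*\<^bsub>with_proj G\<^esub> v" if "v \<in> K" for v using that by (simp add: K_def scc_of_def)
  have step: "b \<in> K" if "(a, b) \<in> parcs G" "a \<in> K" for a b
  proof -
    have "u \<rightarrow>\<^sup>*\<^bsub>with_proj G\<^esub> b" using reach[OF that(2)] that(1) by (auto intro: reachable_adj_trans)
    \<comment> \<open>Symmetry turns reachability from \<open>u\<close> into mutual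
      reachability.\<close>
    then show ?thesis using symmetric_reachable' by (simp add: K_def scc_of_def)
  qed
  then have sat: "a \<in> K \<longleftrightarrow> b \<in> K" if "(a, b) \<in> parcs G" for a b
    using that pair_graph_arcs(4)[OF pair_graph] by blast
  have "with_proj G \<restriction> K \<in> sccs" using K in_sccs_verts_conv by blast
  then obtain H where H: "H \<in> \<F>" and iso: "digraph_iso (with_proj G \<restriction> K) (with_proj H)"
    using closed G unfolding closed_under_components_def by blast
  obtain h where h: "inj_on h K" "pverts H = h ` K"
    "parcs H = map_prod h h ` {e \<in> parcs G. fst e \<in> K \<and> snd e \<in> K}"
    using digraph_iso_with_projE[OF iso]
    by (auto simp: induce_subgraph_def)
  \<comment> \<open>The value \<open>h u\<close> outside \<open>K\<close> keeps the image inside the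
    vertex set of \<open>H\<close> and turns every arc outside \<open>K\<close> into a loop.\<close>
  define f where "f x = (if x \<in> K then h x else h u)" for x
  have H_noloop: "x \<noteq> y" if "(x, y) \<in> parcs H" for x y
    using pair_graph_arcs(3)[OF graphs[rule_format, OF H] that] .
  have "parcs (quotient_graph f G) = parcs H"
  proof (intro set_eqI, clarify, intro iffI)
    fix x y assume "(x, y) \<in> parcs (quotient_graph f G)"
    then obtain a b where ab: "(a, b) \<in> parcs G" "x = f a" "y = f b" "x \<noteq> y"
      by (auto simp: in_parcs_quotient)
    then have "a \<in> K" "b \<in> K" using sat[OF ab(1)] by (auto simp: f_def split: if_splits)
    with ab show "(x, y) \<in> parcs H" unfolding h(3) f_def by force
  next
    fix x y assume xy: "(x, y) \<in> parcs H"
    then obtain a b where "(a, b) \<in> parcs G" "a \<in> K" "b \<in> K" "x = h a" "y = h b"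
      unfolding h(3) by auto
    with H_noloop[OF xy] show "(x, y) \<in> parcs (quotient_graph f G)"
      by (auto simp: in_parcs_quotient f_def intro!: bexI[of _ "(a, b)"])
  qed
  moreover have "f ` pverts G = h ` K" using KV uK u by (auto simp: f_def)
  ultimately have "quotient_graph f G = H" using h(2) by simp
  moreover have "inj_on f K" using h(1) by (auto simp: inj_on_def f_def)
  ultimately show ?thesis
    using that[of K f] uK KV reach sat H by (simp add: f_def)
qed

text \<open>Arcs outside \<open>K\<close> become loops at \<open>z\<close> and vanish; the surviving
  ones come from \<open>K\<close>, where \<open>f\<close> is injective.\<close>

lemma antisym_quotient_component:
  assumes D: "oriented_graph D" and sat: "\<And>a b. (a, b) \<in> parcs D \<Longrightarrow> a \<in> K \<longleftrightarrow> b \<in> K"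
    and inj: "inj_on f K" and out: "\<And>w. w \<notin> K \<Longrightarrow> f w = z"
  shows "antisym (parcs (quotient_graph f D))"
proof (rule antisymI, rule ccontr)
  fix x y
  assume "(x, y) \<in> parcs (quotient_graph f D)" "(y, x) \<in> parcs (quotient_graph f D)" and ne: "x \<noteq> y"
  then obtain a b c d where ab: "(a, b) \<in> parcs D" "x = f a" "y = f b"
    and cd: "(c, d) \<in> parcs D" "y = f c" "x = f d"
    by (auto simp: in_parcs_quotient)
  then have "a \<in> K" "b \<in> K" "c \<in> K" "d \<in> K" using sat out ne by metis+
  then have "a = d" "b = c" using inj ab cd by (auto dest: inj_onD)
  then show False using D ab cd ne by (auto simp: oriented_graph_iff antisym_def)
qed

text \<open>Supplies the descent: identifying two vertices lowers the vertex count, and a surviving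
  arc ensures that \<open>simple_chromatic_number\<close> does not drop.\<close>

lemma proper_quotient_exists:
  assumes graphs: "\<forall>G \<in> \<F>. pair_graph G" and contr: "closed_under_edge_contraction \<F>"
    and comps: "closed_under_components \<F>"
    and D: "irreflexive_oriented_graph D" and G: "mk_symmetric (with_proj D) \<in> \<F>"
    and ncc: "\<not> complete_convex D"
  obtains f where "quotient_graph f (mk_symmetric (with_proj D)) \<in> \<F>"
    "antisym (parcs (quotient_graph f D))" "parcs (quotient_graph f D) \<noteq> {}" "\<not> inj_on f (pverts D)"
proof -
  let ?G = "mk_symmetric (with_proj D)"
  have og: "oriented_graph D" using D by (simp add: irreflexive_oriented_graph_iff)
  note sym = in_parcs_mk_symmetric[of _ _ D]
  obtain u v where uv: "(u, v) \<in> parcs D" and ne: "convex_verts D hull {u, v} \<noteq> pverts D"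
    using ncc by (auto simp: complete_convex_def)
  have V: "u \<in> pverts D" "v \<in> pverts D" using uv og by (auto simp: oriented_graph_iff)
  have nloop: "u \<noteq> v" using uv D by (auto simp: irreflexive_oriented_graph_iff)
  have "convex_verts D hull {u, v} \<subseteq> pverts D"
    using V by (intro hull_minimal) (auto simp: convex_verts_def)
  then obtain x where x: "x \<in> pverts D" "x \<notin> convex_verts D hull {u, v}" using ne by blast
  \<comment> \<open>The hull is an intersection, so some convex set around the arc already omits
    \<open>x\<close>.\<close>
  then obtain C where C: "convex_verts D C" "u \<in> C" "v \<in> C" "x \<notin> C"
    unfolding hull_def by auto
  obtain S where S: "u \<in> S" "v \<in> S" "S \<subseteq> C" "convex_verts D S" "contractible \<F> ?G S"
    using contractible_convex_extension[OF graphs contr G uv C(1-3)] .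
  \<comment> \<open>An arc across the boundary of \<open>S\<close> survives the contraction of
    \<open>S\<close>. Without such an arc \<open>S\<close> contains the whole component of
    \<open>u\<close>, and \<open>x\<close> lies in another component.\<close>
  show ?thesis
  proof (cases "\<exists>(a, b) \<in> parcs D. a \<in> S \<longleftrightarrow> b \<notin> S")
    case True
    then obtain a b where ab: "(a, b) \<in> parcs D" "a \<in> S \<longleftrightarrow> b \<notin> S" by blast
    obtain f where f: "quotient_graph f ?G \<in> \<F>" and
      ker: "\<And>x y. x \<in> pverts D \<Longrightarrow> y \<in> pverts D \<Longrightarrow> f x = f y \<longleftrightarrow> x = y \<or> x \<in> S \<and> y \<in> S"
      using S(5) by (auto simp: contractible_def)
    have "a \<in> pverts D" "b \<in> pverts D" using ab og by (auto simp: oriented_graph_iff)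
    then have "f a \<noteq> f b" using ker ab(2) by blast
    then have "(f a, f b) \<in> parcs (quotient_graph f D)" using ab(1) by (auto simp: in_parcs_quotient)
    moreover have "\<not> inj_on f (pverts D)" using ker V S(1,2) nloop by (auto simp: inj_on_def)
    ultimately show ?thesis
      using that[OF f antisym_quotient_convex[OF og S(4) ker]] by blast
  next
    case False
    interpret G: pair_graph ?G using graphs G by blast
    have u: "u \<in> pverts ?G" using V by simp
    obtain f K where K: "u \<in> K" "K \<subseteq> pverts ?G" "\<And>v. v \<in> K \<Longrightarrow> u \<rightarrow>\<^sup>*\<^bsub>with_proj ?G\<^esub> v"
      "\<And>a b. (a, b) \<in> parcs ?G \<Longrightarrow> a \<in> K \<longleftrightarrow> b \<in> K" "inj_on f K"
      "\<And>w. w \<notin> K \<Longrightarrow> f w = f u" "quotient_graph f ?G \<in> \<F>"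
      by (rule component_quotient[OF graphs comps G u]) (rule that)
    have sat: "a \<in> K \<longleftrightarrow> b \<in> K" if "(a, b) \<in> parcs D" for a b
      using K(4) that sym by blast
    have "w \<in> S" if "u \<rightarrow>\<^sup>*\<^bsub>with_proj ?G\<^esub> w" for w
      using that
    proof (induction rule: G.reachable_induct)
      case base
      show ?case by (rule S(1))
    next
      case (step y z)
      then have "(y, z) \<in> parcs D \<or> (z, y) \<in> parcs D" by (simp add: sym)
      then show ?case using False step.IH by blast
    qed
    then have "x \<notin> K" using K(3) C(4) S(3) by blast
    \<comment> \<open>The vertex \<open>x\<close> is folded onto \<open>u\<close>, while the arc
      \<open>uv\<close> lies inside \<open>K\<close> and survives.\<close>
    then have ninj: "\<not> inj_on f (pverts D)"
      using K(1,6) x(1) V(1) by (metis inj_onD)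
    have "v \<in> K" using sat[OF uv] K(1) by simp
    then have "f u \<noteq> f v" using K(1,5) nloop by (metis inj_onD)
    then have "(f u, f v) \<in> parcs (quotient_graph f D)" using uv by (auto simp: in_parcs_quotient)
    with ninj show ?thesis
      using that[OF K(7) antisym_quotient_component[OF og sat K(5,6)]] by blast
  qed
qed

section \<open>Descent to complete-convex orientations by induction on the number of
  vertices\<close>

lemma simple_chromatic_number_le_complete_convex:
  assumes graphs: "\<forall>G \<in> \<F>. pair_graph G" and contr: "closed_under_edge_contraction \<F>"
    and comps: "closed_under_components \<F>"
    and "D \<in> family_orientations \<F>"
  shows "\<exists>E \<in> complete_convex_orientations \<F>. simple_chromatic_number D \<le> chromatic_number E"
  using assms(4)
proof (induction "card (pverts D)" arbitrary: D rule: less_induct)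
  case less
  show ?case
  proof (cases "complete_convex D")
    case True
    then show ?thesis
      using less.prems simple_chromatic_number_le_chromatic_number
      by (auto simp: complete_convex_orientations_def)
  next
    case False
    have D: "irreflexive_oriented_graph D" "mk_symmetric (with_proj D) \<in> \<F>"
      using less.prems by (auto simp: family_orientations_def orientations_def)
    then have og: "oriented_graph D" by (simp add: irreflexive_oriented_graph_iff)
    obtain f where f: "quotient_graph f (mk_symmetric (with_proj D)) \<in> \<F>"
      "antisym (parcs (quotient_graph f D))" "parcs (quotient_graph f D) \<noteq> {}" "\<not> inj_on f (pverts D)"
      using proper_quotient_exists[OF graphs contr comps D False] .
    have fin: "finite (pverts D)" using og by (simp add: oriented_graph_iff)
    then have "card (pverts (quotient_graph f D)) < card (pverts D)"
      using f(4) card_image_le[OF fin, of f] eq_card_imp_inj_on[OF fin, of f] by force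
    \<comment> \<open>The same \<open>f\<close> acts on \<open>D\<close> and on its underlying
      graph, so the quotient orients a member of the family.\<close>
    moreover have "quotient_graph f D \<in> family_orientations \<F>"
      using f(1) irreflexive_oriented_graph_quotient[OF og f(2)]
      by (auto simp: family_orientations_def orientations_def mk_symmetric_quotient)
    ultimately obtain E where "E \<in> complete_convex_orientations \<F>"
      "simple_chromatic_number (quotient_graph f D) \<le> chromatic_number E"
      using less.hyps by blast
    then show ?thesis
      using simple_chromatic_number_quotient[OF og f(3)] order.trans by blast
  qed
qed

theorem theorem35:
  fixes \<F> :: "'a pair_pre_digraph set"
  assumes "\<forall>G \<in> \<F>. pair_graph G"
    and "closed_under_edge_contraction \<F>"
    and "closed_under_components \<F>"
  shows "family_simple_chromatic_number (family_orientations \<F>) =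
         family_chromatic_number (complete_convex_orientations \<F>)"
proof -
  \<comment> \<open>Both sides are infima of sets of upper bounds, so it suffices that these sets
    agree, which also covers \<open>k\<close> infinite.\<close>
  have "(\<forall>D \<in> family_orientations \<F>. simple_chromatic_number D \<le> k) \<longleftrightarrow>
        (\<forall>D \<in> complete_convex_orientations \<F>. chromatic_number D \<le> k)" for k
  proof (intro iffI ballI)
    fix D
    assume le: "\<forall>D \<in> family_orientations \<F>. simple_chromatic_number D \<le> k"
      and D: "D \<in> complete_convex_orientations \<F>"
    then have "oriented_graph D" "complete_convex D" "D \<in> family_orientations \<F>"
      by (auto simp: complete_convex_orientations_def family_orientations_def orientations_def
          irreflexive_oriented_graph_iff)
    then show "chromatic_number D \<le> k"
      using le chromatic_number_le_simple_chromatic_number order.trans by blast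
  next
    fix D
    assume "\<forall>D \<in> complete_convex_orientations \<F>. chromatic_number D \<le> k"
      and "D \<in> family_orientations \<F>"
    then show "simple_chromatic_number D \<le> k"
      using simple_chromatic_number_le_complete_convex[OF assms] order.trans by blast
  qed
  then show ?thesis
    by (simp add: family_simple_chromatic_number_def family_chromatic_number_def)
qed

end
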